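(* (a) If $m, n$ are integers with $1 < m < n$, then \[ \sum_{d=1}^{n+1} \mu(d)\, 2^{\lfloor (n+1)/d\rfloor - \lfloor (n-1)/d\rfloor + \lfloor m/d\rfloor - \lfloor (m-1)/d\rfloor} = \begin{cases} 2 + M(n+1), & \text{if } (m,n)>1 \text{ and } (m,n+1)>1,\\ 3 + M(n+1), & \text{if } (m,n)=1 \text{ and } (m,n+1)>1, \text{ or } (m,n)>1 \text{ and } (m,n+1)=1,\\ 4 + M(n+1), & \text{if } (m,n)=(m,n+1)=1.\end{cases} \] (b) If $m, n$ are integers with $1 < n < m-1$, then \[ \sum_{d=1}^{m} \mu(d)\, 2^{\lfloor (n+1)/d\rfloor - \lfloor (n-1)/d\rfloor + \lfloor m/d\rfloor - \lfloor (m-1)/d\rfloor} = \begin{cases} 2 + M(m), & \text{if } (m,n)>1 \text{ and } (m,n+1)>1,\\ 3 + M(m), & \text{if } (m,n)=1 \text{ and } (m,n+1)>1, \text{ or } (m,n)>1 \text{ and } (m,n+1)=1,\\ 4 + M(m), & \text{if } (m,n)=(m,n+1)=1.\end{cases} \]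
   Context: $\mu$ is the Möbius function, $\lfloor x\rfloor$ is the floor of $x$, $(a,b)$ denotes $\gcd(a,b)$, and $M(n) = \sum_{d=1}^n \mu(d)$ is the Mertens function. *)

theory Defs
  imports Complex_Main "HOL-Computational_Algebra.Squarefree"
begin

definition moebius_mu :: "nat \<Rightarrow> int" where
  "moebius_mu n = (if squarefree n then (-1) ^ card (prime_factors n) else 0)"

definition Mertens :: "nat \<Rightarrow> int" where
  "Mertens n = (\<Sum>d=1..n. moebius_mu d)"

end

theory Submission
  imports Defs
begin

text \<open>
  The exponent counts which of \<open>m\<close>, \<open>n\<close>, \<open>n + 1\<close> are divisible by \<open>d\<close>, so the power of 2
  equals \<open>(1 + [d | n]) (1 + [d | n + 1]) (1 + [d | m])\<close>. Expanding the product, every term but the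
  first sums \<open>\<mu>\<close> over the divisors of \<open>n\<close>, \<open>n + 1\<close>, \<open>m\<close> or of one of their gcds, and such a sum is 1
  or 0 according to whether that number is 1 or not.
\<close>

lemma moebius_mu_1 [simp]: "moebius_mu (Suc 0) = 1"
  by (simp add: moebius_mu_def)

text \<open>The new prime \<open>p\<close> raises the number of prime factors by one and keeps
  squarefreeness in both directions; if \<open>d\<close> is not squarefree, both sides are
  0.\<close>

lemma moebius_mu_prime_mult:
  assumes p: "prime p" and "\<not> p dvd d"
  shows "moebius_mu (p * d) = - moebius_mu d"
proof -
  have d0: "d \<noteq> 0" and cop: "coprime p d"
    using assms by (auto intro: prime_imp_coprime intro!: Nat.gr0I)
  have sf: "squarefree (p * d) \<longleftrightarrow> squarefree d"
    using squarefree_prime p cop by (auto intro: squarefree_mult_coprime dest: squarefree_multD)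
  have "prime_factors (p * d) = insert p (prime_factors d)"
    using p d0 by (auto simp: prime_factors_product prime_prime_factors)
  moreover have "p \<notin> prime_factors d"
    using assms by (auto simp: in_prime_factors_iff)
  ultimately show ?thesis
    by (simp add: moebius_mu_def sf)
qed

text \<open>For \<open>n > 1\<close>, fix a prime \<open>p\<close> dividing \<open>n\<close>. Only
  squarefree divisors contribute, and they cancel in pairs \<open>d\<close>, \<open>p * d\<close>
  with \<open>d\<close> not divisible by \<open>p\<close>, because multiplication by
  \<open>p\<close> flips the sign of the Moebius function.\<close>

lemma sum_moebius_mu_divisors:
  assumes "n > 0"
  shows "(\<Sum>d | d dvd n. moebius_mu d) = of_bool (n = 1)"
proof (cases "n = 1")
  case True
  then have "{d. d dvd n} = {1}" by auto
  then show ?thesis using True by simp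
next
  case False
  then obtain p where p: "prime p" "p dvd n"
    using prime_factor_nat by blast
  have fin: "finite {d. d dvd n}" using assms by simp
  let ?A = "{d. d dvd n \<and> squarefree d \<and> \<not> p dvd d}"
  let ?B = "{d. d dvd n \<and> squarefree d \<and> p dvd d}"
  have "(\<Sum>d | d dvd n. moebius_mu d) = (\<Sum>d\<in>?A \<union> ?B. moebius_mu d)"
    using fin by (intro sum.mono_neutral_right) (auto simp: moebius_mu_def split: if_splits)
  also have "\<dots> = sum moebius_mu ?A + sum moebius_mu ?B"
    using fin by (intro sum.union_disjoint) auto
  also have "sum moebius_mu ?B = (\<Sum>d\<in>?A. moebius_mu (p * d))"
  proof (rule sum.reindex_bij_witness[of _ "\<lambda>d. p * d" "\<lambda>d. d div p"])
    fix d assume d: "d \<in> ?B"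
    then obtain e where e: "d = p * e" by auto
    \<comment> \<open>Squarefreeness of \<open>d\<close> excludes a second factor \<open>p\<close>,
      so division by \<open>p\<close> really lands in \<open>?A\<close>.\<close>
    have "\<not> p dvd e"
    proof
      assume "p dvd e"
      then have "p ^ 2 dvd d" using e by (auto simp: power2_eq_square)
      then have "is_unit p" using d by (auto simp: squarefree_def)
      then show False using p by auto
    qed
    then show "d div p \<in> ?A"
      using d e p by (auto intro: dvd_mult_right dest: squarefree_multD)
    show "p * (d div p) = d" "moebius_mu (p * (d div p)) = moebius_mu d"
      using e p by auto
  next
    fix d assume d: "d \<in> ?A"
    then have cop: "coprime p d" using p prime_imp_coprime by auto
    show "p * d div p = d" using p by auto
    show "p * d \<in> ?B"
      using d p cop by (auto intro: divides_mult squarefree_mult_coprime squarefree_prime)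
  qed
  also have "\<dots> = - sum moebius_mu ?A"
    by (simp add: moebius_mu_prime_mult p(1) flip: sum_negf)
  finally show ?thesis using False by simp
qed

text \<open>Divisor sums for different \<open>k\<close> are brought to one common range so that they
  can be added termwise; \<open>k \<le> N\<close> ensures that no divisor is cut off.\<close>

lemma sum_moebius_mu_of_bool_dvd:
  assumes "k > 0" "k \<le> N"
  shows "(\<Sum>d=1..N. moebius_mu d * of_bool (d dvd k)) = of_bool (k = 1)"
proof -
  have "d \<ge> 1" "d \<le> N" if "d dvd k" for d
    using that assms dvd_imp_le[of d k] dvd_pos_nat[of k d] by auto
  then have "(\<Sum>d=1..N. moebius_mu d * of_bool (d dvd k)) = (\<Sum>d | d dvd k. moebius_mu d)"
    by (intro sum.mono_neutral_cong_right) auto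
  then show ?thesis using sum_moebius_mu_divisors assms by simp
qed

lemma floor_divide_Suc_diff:
  assumes "d > 0"
  shows "\<lfloor>real (Suc k) / real d\<rfloor> - \<lfloor>real k / real d\<rfloor> = of_bool (d dvd Suc k)"
  unfolding floor_divide_of_nat_eq by (auto simp: div_Suc dvd_eq_mod_eq_0)

lemma two_powi_floor_differences:
  assumes "d > 0" "n > 0" "m > 0"
  shows "2 powi (\<lfloor>(real n + 1) / real d\<rfloor> - \<lfloor>(real n - 1) / real d\<rfloor>
                   + \<lfloor>real m / real d\<rfloor> - \<lfloor>(real m - 1) / real d\<rfloor>)
         = real_of_int ((1 + of_bool (d dvd n)) * (1 + of_bool (d dvd n + 1)) * (1 + of_bool (d dvd m)))"
proof -
  \<comment> \<open>With successors, \<open>real n - 1\<close> and \<open>real m - 1\<close> are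
    casts of naturals. The difference between \<open>n + 1\<close> and \<open>n - 1\<close> then
    splits at \<open>n\<close> into two unit steps.\<close>
  obtain n' m' where nm: "n = Suc n'" "m = Suc m'"
    using assms by (metis gr0_implies_Suc)
  have "\<lfloor>(real n + 1) / real d\<rfloor> - \<lfloor>(real n - 1) / real d\<rfloor> + \<lfloor>real m / real d\<rfloor> - \<lfloor>(real m - 1) / real d\<rfloor>
      = of_bool (d dvd n) + of_bool (d dvd n + 1) + of_bool (d dvd m)"
    using floor_divide_Suc_diff[OF assms(1), of n'] floor_divide_Suc_diff[OF assms(1), of n]
      floor_divide_Suc_diff[OF assms(1), of m']
    by (simp add: nm add.commute)
  then show ?thesis
    by (simp add: power_int_def)
qed

text \<open>Leaving the upper limit \<open>N\<close> free treats both parts of the theorem at once: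
  it only has to reach \<open>n + 1\<close> and \<open>m\<close>, so that all divisors involved are
  in range.\<close>

lemma sum_moebius_mu_two_powi:
  assumes "n > 1" "m > 1" "n + 1 \<le> N" "m \<le> N"
  shows "(\<Sum>d=1..N. real_of_int (moebius_mu d) *
              2 powi (\<lfloor>(real n + 1) / real d\<rfloor> - \<lfloor>(real n - 1) / real d\<rfloor>
                       + \<lfloor>real m / real d\<rfloor> - \<lfloor>(real m - 1) / real d\<rfloor>))
         = 2 + of_bool (gcd m n = 1) + of_bool (gcd m (n + 1) = 1) + real_of_int (Mertens N)"
    (is "?S = _")
proof -
  let ?D = "\<lambda>k. \<Sum>d=1..N. moebius_mu d * of_bool (d dvd k)"
  have gcd_le: "gcd m k \<le> N" "gcd m k > 0" for k
    using assms by (auto intro: le_trans[OF gcd_le1_nat])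
  have "?S = real_of_int (\<Sum>d=1..N. moebius_mu d *
      ((1 + of_bool (d dvd n)) * (1 + of_bool (d dvd n + 1)) * (1 + of_bool (d dvd m))))"
    unfolding of_int_sum using assms
    by (intro sum.cong) (auto simp: two_powi_floor_differences)
  also have "(\<Sum>d=1..N. moebius_mu d *
      ((1 + of_bool (d dvd n)) * (1 + of_bool (d dvd n + 1)) * (1 + of_bool (d dvd m))))
      = (\<Sum>d=1..N. moebius_mu d + moebius_mu d * of_bool (d dvd n)
          + moebius_mu d * of_bool (d dvd n + 1) + moebius_mu d * of_bool (d dvd m)
          + moebius_mu d * of_bool (d dvd 1) + moebius_mu d * of_bool (d dvd gcd m n)
          + moebius_mu d * of_bool (d dvd gcd m (n + 1)) + moebius_mu d * of_bool (d dvd 1))"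
  proof (intro sum.cong refl)
    fix d
    \<comment> \<open>Consecutive numbers are coprime. Hence the two products containing both
      \<open>d dvd n\<close> and \<open>d dvd n + 1\<close>, with and without
      \<open>d dvd m\<close>, each reduce to \<open>d dvd 1\<close>.\<close>
    have "d dvd 1 \<longleftrightarrow> d dvd n \<and> d dvd n + 1"
      by (metis dvd_add_right_iff one_dvd dvd_trans)
    then show "moebius_mu d *
      ((1 + of_bool (d dvd n)) * (1 + of_bool (d dvd n + 1)) * (1 + of_bool (d dvd m)))
      = moebius_mu d + moebius_mu d * of_bool (d dvd n)
          + moebius_mu d * of_bool (d dvd n + 1) + moebius_mu d * of_bool (d dvd m)
          + moebius_mu d * of_bool (d dvd 1) + moebius_mu d * of_bool (d dvd gcd m n)
          + moebius_mu d * of_bool (d dvd gcd m (n + 1)) + moebius_mu d * of_bool (d dvd 1)"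
      by (cases "d dvd n"; cases "d dvd n + 1"; cases "d dvd m") auto
  qed
  also have "\<dots> = Mertens N + ?D n + ?D (n + 1) + ?D m + ?D 1 + ?D (gcd m n) + ?D (gcd m (n + 1)) + ?D 1"
    unfolding Mertens_def by (simp only: sum.distrib)
  \<comment> \<open>The sums for \<open>n\<close>, \<open>n + 1\<close> and \<open>m\<close> vanish
    since these exceed 1; the constant 2 comes from the two copies of \<open>?D 1\<close>.\<close>
  also have "\<dots> = 2 + of_bool (gcd m n = 1) + of_bool (gcd m (n + 1) = 1) + Mertens N"
    using assms gcd_le[of n] gcd_le[of "n + 1"]
    by (simp only: sum_moebius_mu_of_bool_dvd) simp
  finally show ?thesis by simp
qed

theorem theorem6:
  fixes m n :: nat
  shows
    "(1 < m \<and> m < n \<longrightarrow>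
       (let S = (\<Sum>d=1..n+1. real_of_int (moebius_mu d) *
              2 powi (\<lfloor>(real n + 1) / real d\<rfloor> - \<lfloor>(real n - 1) / real d\<rfloor>
                       + \<lfloor>real m / real d\<rfloor> - \<lfloor>(real m - 1) / real d\<rfloor>))
        in (gcd m n > 1 \<and> gcd m (n+1) > 1 \<longrightarrow> S = 2 + real_of_int (Mertens (n+1)))
         \<and> ((gcd m n = 1 \<and> gcd m (n+1) > 1) \<or> (gcd m n > 1 \<and> gcd m (n+1) = 1)
               \<longrightarrow> S = 3 + real_of_int (Mertens (n+1)))
         \<and> (gcd m n = 1 \<and> gcd m (n+1) = 1 \<longrightarrow> S = 4 + real_of_int (Mertens (n+1)))))
     \<and>
     (1 < n \<and> n < m - 1 \<longrightarrow>
       (let S = (\<Sum>d=1..m. real_of_int (moebius_mu d) *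
              2 powi (\<lfloor>(real n + 1) / real d\<rfloor> - \<lfloor>(real n - 1) / real d\<rfloor>
                       + \<lfloor>real m / real d\<rfloor> - \<lfloor>(real m - 1) / real d\<rfloor>))
        in (gcd m n > 1 \<and> gcd m (n+1) > 1 \<longrightarrow> S = 2 + real_of_int (Mertens m))
         \<and> ((gcd m n = 1 \<and> gcd m (n+1) > 1) \<or> (gcd m n > 1 \<and> gcd m (n+1) = 1)
               \<longrightarrow> S = 3 + real_of_int (Mertens m))
         \<and> (gcd m n = 1 \<and> gcd m (n+1) = 1 \<longrightarrow> S = 4 + real_of_int (Mertens m))))"
proof (intro conjI impI, goal_cases)
  case 1
  \<comment> \<open>Here \<open>N\<close> is \<open>n + 1\<close>, and in the second case it is
    \<open>m\<close>; the three values correspond to how many of the two gcds equal 1.\<close>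
  then have "n > 1" "m > 1" "m \<le> n + 1" by auto
  note sum_moebius_mu_two_powi[OF this(1,2) order.refl this(3)]
  then show ?case by (simp only: Let_def) auto
next
  case 2
  then have "n > 1" "m > 1" "n + 1 \<le> m" by auto
  note sum_moebius_mu_two_powi[OF this order.refl]
  then show ?case by (simp only: Let_def) auto
qed

end
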